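(* Let $b\ge2$ be an integer, $A=\{1,b\}$, and let $X$ be a nonempty finite binary string with no subperiod (i.e. the infinite word $X^\infty$ has least period $|X|$). Then $X^\infty\in\mathcal W^A$ if and only if $|X|$ divides $1+b$ and $X$ is a cyclic rotation of a concatenation of copies of the blocks $01$ and $011$.
   Context: For a finite nonempty set $A$ of positive integers let $\alpha=\max A$. For a seed $S=s_1\cdots s_\alpha\in\{0,1\}^\alpha$, define $w^{A,S}(-\alpha-1+j)=s_j$ for $j=1,\ldots,\alpha$ and $w^{A,S}(n)=1-\min\{w^{A,S}(n-x):x\in A\}$ for $n\ge0$. $\mathcal W^A=\{(w^{A,S}(n))_{n\ge0}: S\in\{0,1\}^\alpha\}$. $X^\infty$ denotes the infinite word $XXX\cdots$, indexed from $0$. A cyclic rotation of a string $y_0\cdots y_{\ell-1}$ is a string $y_t y_{t+1}\cdots y_{\ell-1}y_0\cdots y_{t-1}$. *)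

theory Defs
  imports Main
begin

text \<open>
  Bits are the natural numbers 0 and 1.  \<open>word_from A S\<close> is the extended word
  \<open>w\<close> determined by the seed \<open>S\<close>: the list entry \<open>S ! (j - 1)\<close> is \<open>s\<^sub>j\<close>, placed at position
  \<open>- Max A - 1 + j\<close>.  Positions below \<open>- Max A\<close> carry an irrelevant value.  The restriction
  to positive elements of \<open>A\<close> only ensures termination; it is vacuous for the sets \<open>A\<close>
  of interest (see \<open>word_from_rec\<close>).
\<close>

function word_from :: "nat set \<Rightarrow> nat list \<Rightarrow> int \<Rightarrow> nat" where
  "word_from A S n =
     (if n < 0 then S ! nat (n + int (Max A))
      else 1 - Min ((\<lambda>x. word_from A S (n - int x)) ` {x \<in> A. 0 < x}))"
  by pat_completeness auto
termination
  by (relation "measure (\<lambda>(A, S, n). nat (n + 1))") auto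

declare word_from.simps [simp del]

lemma word_from_seed:
  assumes "1 \<le> j" and "j \<le> Max A"
  shows "word_from A S (- int (Max A) - 1 + int j) = S ! (j - 1)"
proof -
  have "nat (- int (Max A) - 1 + int j + int (Max A)) = j - 1"
    using assms by simp
  then show ?thesis
    using assms by (subst word_from.simps) simp
qed

lemma word_from_rec:
  assumes "\<And>x. x \<in> A \<Longrightarrow> 0 < x" and "0 \<le> n"
  shows "word_from A S n = 1 - Min {word_from A S (n - int x) | x. x \<in> A}"
proof -
  have "{x \<in> A. 0 < x} = A"
    using assms(1) by auto
  then show ?thesis
    using assms(2) by (subst word_from.simps) (simp add: image_def Bex_def conj_commute)
qed

definition seeds :: "nat set \<Rightarrow> nat list set" where
  "seeds A = {S. length S = Max A \<and> set S \<subseteq> {0, 1}}"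

definition words :: "nat set \<Rightarrow> (nat \<Rightarrow> nat) set" where
  "words A = {(\<lambda>n. word_from A S (int n)) | S. S \<in> seeds A}"

definition infinite_power :: "'a list \<Rightarrow> nat \<Rightarrow> 'a" where
  "infinite_power X n = X ! (n mod length X)"

definition least_period :: "(nat \<Rightarrow> 'a) \<Rightarrow> nat" where
  "least_period f = (LEAST p. 0 < p \<and> (\<forall>n. f (n + p) = f n))"

definition cyclic_rotation :: "'a list \<Rightarrow> 'a list \<Rightarrow> bool" where
  "cyclic_rotation X Y \<longleftrightarrow> (\<exists>t < length Y. X = drop t Y @ take t Y)"

end

theory Submission imports Defs begin

text \<open>
  For a periodic word \<open>x\<close>, membership in the set of words of \<open>{1, b}\<close> means that
  \<open>x n = 0\<close> iff \<open>x (n - 1) = x (n - b) = 1\<close>, for all integers \<open>n\<close>. A zero at \<open>n\<close> thus forces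
  ones at \<open>n + 1\<close> and \<open>n + b\<close>, and these force a zero at \<open>n + b + 1\<close>. Going round the
  period, the zero set is invariant under translation by \<open>b + 1\<close>, so the least period divides
  \<open>b + 1\<close>. Given this period, \<open>x (n - b) = x (n + 1)\<close> and the recurrence says that a letter is
  0 iff both of its neighbours are 1, which means that neither 00 nor 111 occurs; that is, \<open>x\<close>
  is composed of the blocks 01 and 011.
\<close>

text \<open>The centre is \<open>Suc n\<close> so that a left neighbour exists; in a periodic word,
  position 0 is covered by its later copies.\<close>

definition zero_iff_between_ones :: "(nat \<Rightarrow> nat) \<Rightarrow> bool" where
  "zero_iff_between_ones f \<longleftrightarrow> (\<forall>n. f (Suc n) = 0 \<longleftrightarrow> f n = 1 \<and> f (Suc (Suc n)) = 1)"

section \<open>Periods, infinite powers and rotations\<close>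

lemma periodic_mult:
  fixes f :: "nat \<Rightarrow> 'a"
  assumes "\<And>n. f (n + p) = f n"
  shows "f (n + k * p) = f n"
proof (induction k)
  case (Suc k)
  have "f (n + Suc k * p) = f ((n + k * p) + p)"
    by (simp add: algebra_simps)
  with Suc assms show ?case
    by simp
qed simp

text \<open>The remainder \<open>q mod ?p\<close> also shifts \<open>f\<close> to itself; being
  smaller than the least period, it must be 0.\<close>

lemma least_period_dvd:
  assumes "0 < q" and period: "\<And>n. f (n + q) = f n"
  shows "least_period f dvd q"
proof -
  let ?P = "\<lambda>p. 0 < p \<and> (\<forall>n. f (n + p) = f n)"
  let ?p = "least_period f"
  have p: "?P ?p"
    unfolding least_period_def by (rule LeastI[of ?P q]) (use assms in auto)
  have "f (n + q mod ?p) = f n" for n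
  proof -
    have "f (n + q mod ?p) = f (n + q mod ?p + q div ?p * ?p)"
      using periodic_mult[of f ?p] p by metis
    also have "\<dots> = f n"
      by (simp add: add.assoc period)
    finally show ?thesis .
  qed
  moreover have "q mod ?p < ?p"
    using p by simp
  then have "\<not> ?P (q mod ?p)"
    unfolding least_period_def by (rule not_less_Least)
  ultimately show ?thesis
    by auto
qed

lemma infinite_power_periodic: "infinite_power X (n + length X) = infinite_power X n"
  by (simp add: infinite_power_def)

lemma infinite_power_mem:
  assumes "X \<noteq> []"
  shows "infinite_power X n \<in> set X"
  using assms by (simp add: infinite_power_def)

lemma infinite_power_rotate:
  assumes "Y \<noteq> []"
  shows "infinite_power (rotate t Y) n = infinite_power Y (t + n)"
  using assms by (simp add: infinite_power_def nth_rotate mod_add_right_eq)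

lemma map_infinite_power: "map (infinite_power X) [i..<i + length X] = rotate i X"
  by (rule nth_equalityI) (auto simp: infinite_power_def nth_rotate)

lemma cyclic_rotation_iff_rotate: "cyclic_rotation X Y \<longleftrightarrow> (\<exists>t < length Y. X = rotate t Y)"
  unfolding cyclic_rotation_def by (auto simp: rotate_drop_take)

section \<open>From seeds to a recurrence on natural positions\<close>

lemma word_from_pair:
  assumes "0 < b" and "0 \<le> n"
  shows "word_from {1, b} S n = 1 - min (word_from {1, b} S (n - 1)) (word_from {1, b} S (n - int b))"
proof -
  have "{word_from {1, b} S (n - int x) | x. x \<in> {1, b}}
      = {word_from {1, b} S (n - 1), word_from {1, b} S (n - int b)}"
    unfolding Setcompr_eq_image by simp
  then show ?thesis
    using word_from_rec[of "{1, b}" n S] assms by auto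
qed

text \<open>The right side constrains only positions from \<open>b\<close> on, while the first
  \<open>b\<close> letters of a word also depend on its seed. Periodicity closes this gap: a later
  stretch of \<open>f\<close> serves as the seed.\<close>

lemma periodic_in_words_iff:
  assumes "0 < b" and "0 < p" and period: "\<And>n. f (n + p) = f n"
    and bits: "\<And>n. f n \<in> {0, 1 :: nat}"
  shows "f \<in> words {1, b} \<longleftrightarrow> (\<forall>n. f (n + b) = 1 - min (f (n + b - 1)) (f n))"
    (is "_ \<longleftrightarrow> ?rec")
proof
  assume "f \<in> words {1, b}"
  then obtain S where S: "\<And>n. f n = word_from {1, b} S (int n)"
    unfolding words_def by auto
  show ?rec
  proof
    fix n
    have "int (n + b - 1) = int (n + b) - 1"
      using \<open>0 < b\<close> by simp
    then show "f (n + b) = 1 - min (f (n + b - 1)) (f n)"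
      using word_from_pair[OF \<open>0 < b\<close>, of "int (n + b)" S] by (simp add: S)
  qed
next
  assume rec: ?rec
  \<comment> \<open>The seed sits at positions \<open>-b\<close> to \<open>-1\<close>; moved up by
    \<open>b\<close> periods, these become \<open>d\<close> to \<open>d + b - 1\<close>.\<close>
  define d where "d = b * p - b"
  have d: "d + b = b * p"
    using \<open>0 < p\<close> by (simp add: d_def)
  define S where "S = map f [d..<d + b]"
  have Max: "Max {1, b} = b"
    using \<open>0 < b\<close> by simp
  \<comment> \<open>Counting from the start of the seed keeps the induction variable
    natural.\<close>
  have w: "word_from {1, b} S (int m - int b) = f (d + m)" for m
  proof (induction m rule: less_induct)
    case (less m)
    show ?case
    proof (cases "m < b")
      case True
      then show ?thesis
        using Max by (subst word_from.simps) (simp add: S_def)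
    next
      case False
      then obtain k where m: "m = k + b"
        by (metis add.commute le_add_diff_inverse not_less)
      have 1: "word_from {1, b} S (int m - int b - 1) = f (d + k + b - 1)"
        using less.IH[of "m - 1"] \<open>0 < b\<close> by (simp add: m algebra_simps)
      have 2: "word_from {1, b} S (int m - int b - int b) = f (d + k)"
        using less.IH[of k] \<open>0 < b\<close> by (simp add: m)
      show ?thesis
        using word_from_pair[OF \<open>0 < b\<close>, of "int m - int b" S] rec[rule_format, of "d + k"]
        unfolding 1 2 by (simp add: m add.assoc)
    qed
  qed
  have "f n = word_from {1, b} S (int n)" for n
  proof -
    have "word_from {1, b} S (int n) = f (d + (n + b))"
      using w[of "n + b"] by simp
    also have "d + (n + b) = n + b * p"
      using d by simp
    also have "f \<dots> = f n"
      by (rule periodic_mult[of f p, OF period])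
    finally show ?thesis
      by simp
  qed
  moreover have "S \<in> seeds {1, b}"
    using bits Max by (simp add: seeds_def S_def image_subset_iff)
  ultimately show "f \<in> words {1, b}"
    unfolding words_def by blast
qed

section \<open>The period \<open>b + 1\<close> and the local form of the recurrence\<close>

lemma recurrence_imp_period:
  fixes b p :: nat
  assumes "0 < b" and "0 < p" and period: "\<And>n. f (n + p) = f n"
    and bits: "\<And>n. f n \<in> {0, 1 :: nat}"
    and rec: "\<And>n. f (n + b) = 1 - min (f (n + b - 1)) (f n)"
  shows "f (n + (b + 1)) = f n"
proof -
  have step: "f (n + (b + 1)) = 0" if "f n = 0" for n
  proof -
    have "f (n + b) = 1"
      using rec[of n] that by simp
    moreover have "f (n + 1) = 1"
    proof -
      \<comment> \<open>The recurrence for position \<open>n + 1\<close> may look back below 0, so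
        it is applied \<open>b\<close> periods later.\<close>
      define m where "m = n + 1 + (b * p - b)"
      have "b \<le> b * p"
        using \<open>0 < p\<close> by simp
      then have m: "m + b = n + 1 + b * p" "m + b - 1 = n + b * p"
        unfolding m_def by linarith+
      have "f (n + 1 + b * p) = f (n + 1)" "f (n + b * p) = f n"
        by (rule periodic_mult[of f p, OF period])+
      then show ?thesis
        using rec[of m] that unfolding m by simp
    qed
    ultimately show ?thesis
      using rec[of "n + 1"] by simp
  qed
  have steps: "f (n + k * (b + 1)) = 0" if "f n = 0" for n k
  proof (induction k)
    case (Suc k)
    from step[OF this] show ?case
      by (simp add: algebra_simps)
  qed (simp add: that)
  \<comment> \<open>Conversely, \<open>p - 1\<close> further steps carry the zero to
    \<open>n + (b + 1) * p\<close>, a whole number of periods after \<open>n\<close>.\<close>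
  have "f n = 0" if "f (n + (b + 1)) = 0"
  proof -
    have "n + (b + 1) + (p - 1) * (b + 1) = n + (b + 1) * p"
      using \<open>0 < p\<close> by (cases p) (simp_all add: algebra_simps)
    with steps[OF that, of "p - 1"] have "f (n + (b + 1) * p) = 0"
      by (simp only:)
    then show ?thesis
      by (simp only: periodic_mult[of f p, OF period])
  qed
  with step[of n] bits[of n] bits[of "n + (b + 1)"] show ?thesis
    by auto
qed

text \<open>By the period, \<open>f n\<close> is the letter at \<open>n + b + 1\<close>, so the
  recurrence computes the letter at \<open>n + b\<close> from its two neighbours.\<close>

lemma recurrence_iff_between_ones:
  fixes b :: nat
  assumes "0 < b" and period: "\<And>n. f (n + (b + 1)) = f n"
    and bits: "\<And>n. f n \<in> {0, 1 :: nat}"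
  shows "(\<forall>n. f (n + b) = 1 - min (f (n + b - 1)) (f n)) \<longleftrightarrow> zero_iff_between_ones f"
proof
  assume rec: "\<forall>n. f (n + b) = 1 - min (f (n + b - 1)) (f n)"
  show "zero_iff_between_ones f"
    unfolding zero_iff_between_ones_def
  proof
    fix n
    \<comment> \<open>In the instance at \<open>Suc (Suc n)\<close>, the computed letter and its
      left neighbour are the letters at \<open>Suc n\<close> and \<open>n\<close>, each shifted by
      \<open>b + 1\<close>.\<close>
    have "f (Suc n) = 1 - min (f n) (f (Suc (Suc n)))"
      using rec[rule_format, of "Suc (Suc n)"] period[of n] period[of "Suc n"] by simp
    then show "f (Suc n) = 0 \<longleftrightarrow> f n = 1 \<and> f (Suc (Suc n)) = 1"
      using bits[of n] bits[of "Suc (Suc n)"] by auto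
  qed
next
  assume between: "zero_iff_between_ones f"
  show "\<forall>n. f (n + b) = 1 - min (f (n + b - 1)) (f n)"
  proof
    fix n
    obtain c where "b = Suc c"
      using \<open>0 < b\<close> gr0_implies_Suc by blast
    then show "f (n + b) = 1 - min (f (n + b - 1)) (f n)"
      using between[unfolded zero_iff_between_ones_def, rule_format, of "n + c"] period[of n]
        bits[of n] bits[of "n + c"] bits[of "Suc (n + c)"]
      by auto
  qed
qed

section \<open>Decomposition into blocks\<close>

text \<open>Cut before every zero: consecutive zeros are separated by one or two ones. The zero at
  \<open>k\<close> ensures that the last block is complete.\<close>

lemma between_ones_imp_blocks:
  assumes between: "zero_iff_between_ones f" and bits: "\<And>n. f n \<in> {0, 1}"
    and "i \<le> k" and "f i = 0" and "f k = 0"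
  shows "\<exists>Bs. set Bs \<subseteq> {[0, 1], [0, 1, 1]} \<and> map f [i..<k] = concat Bs"
  using assms(3,4)
proof (induction "k - i" arbitrary: i rule: less_induct)
  case less
  note between = between[unfolded zero_iff_between_ones_def, rule_format]
  show ?case
  proof (cases "i = k")
    case True
    then have "set [] \<subseteq> {[0, 1], [0, 1, 1]} \<and> map f [i..<k] = concat []"
      by simp
    then show ?thesis
      by blast
  next
    case False
    have one: "f (Suc i) = 1"
      using between[of i] bits[of "Suc i"] less.prems by auto
    have ik: "Suc i < k"
      using False less.prems one \<open>f k = 0\<close> by (metis One_nat_def Suc_lessI le_neq_implies_less zero_neq_one)
    \<comment> \<open>Peel off the block that ends just before the next zero \<open>j\<close>, then
      use induction on the rest.\<close>
    have block: ?thesis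
      if "j \<le> k" "i < j" "f j = 0" "map f [i..<j] \<in> {[0, 1], [0, 1, 1]}" for j
    proof -
      have "k - j < k - i"
        using that by simp
      then obtain Bs where "set Bs \<subseteq> {[0, 1], [0, 1, 1]}" "map f [j..<k] = concat Bs"
        using less.hyps[OF _ \<open>j \<le> k\<close> \<open>f j = 0\<close>] by blast
      moreover have "[i..<k] = [i..<j] @ [j..<k]"
        using that upt_add_eq_append[of i j "k - j"] by simp
      ultimately have "set (map f [i..<j] # Bs) \<subseteq> {[0, 1], [0, 1, 1]} \<and>
          map f [i..<k] = concat (map f [i..<j] # Bs)"
        using that by simp
      then show ?thesis
        by blast
    qed
    show ?thesis
    proof (cases "f (Suc (Suc i)) = 0")
      case True
      have "map f [i..<Suc (Suc i)] = [0, 1]"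
        using less.prems one by (simp add: upt_conv_Cons)
      then show ?thesis
        using block[of "Suc (Suc i)"] ik True by simp
    next
      case False
      then have one': "f (Suc (Suc i)) = 1"
        using bits[of "Suc (Suc i)"] by simp
      then have "Suc (Suc (Suc i)) \<le> k"
        using ik \<open>f k = 0\<close> by (metis One_nat_def Suc_leI Suc_lessI zero_neq_one)
      moreover have "f (Suc (Suc (Suc i))) = 0"
        using between[of "Suc i"] bits[of "Suc (Suc (Suc i))"] one one' by auto
      moreover have "map f [i..<Suc (Suc (Suc i))] = [0, 1, 1]"
        using less.prems one one' by (simp add: upt_conv_Cons)
      ultimately show ?thesis
        using block[of "Suc (Suc (Suc i))"] by simp
    qed
  qed
qed

text \<open>A triple of letters starting in one block reaches at most two letters past it, and these
  are always 01, since every block begins so. Only the two block shapes need checking.\<close>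

lemma blocks_imp_between_ones:
  assumes "set Bs \<subseteq> {[0, 1], [0, 1, 1 :: nat]}" and "Bs \<noteq> []"
  shows "zero_iff_between_ones (infinite_power (concat Bs))"
proof -
  have start: "\<exists>V. concat Cs @ [0, 1] = 0 # 1 # V"
    if "set Cs \<subseteq> {[0, 1], [0, 1, 1 :: nat]}" for Cs
    using that by (cases Cs) auto
  \<comment> \<open>The appended 01 stands for the start of the next copy, so that the last block is
    treated like the others.\<close>
  have local: "Z ! Suc n = 0 \<longleftrightarrow> Z ! n = 1 \<and> Z ! Suc (Suc n) = 1"
    if "set Cs \<subseteq> {[0, 1], [0, 1, 1 :: nat]}" "n < length (concat Cs)" "Z = concat Cs @ [0, 1]"
    for Cs n Z
    using that
  proof (induction Cs arbitrary: n Z)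
    case (Cons B Cs)
    obtain V where V: "concat Cs @ [0, 1] = 0 # 1 # V"
      using start[of Cs] Cons.prems by auto
    have Z: "Z = B @ 0 # 1 # V"
      using Cons.prems V by simp
    note IH = Cons.IH[OF _ _ V[symmetric]]
    show ?case
    proof (cases "n < length B")
      case True
      then show ?thesis
        using Cons.prems(1) Z by (auto simp: less_Suc_eq)
    next
      case False
      then obtain m where m: "n = length B + m"
        using le_Suc_ex not_less by blast
      then have "(0 # 1 # V) ! Suc m = 0 \<longleftrightarrow> (0 # 1 # V) ! m = 1 \<and> (0 # 1 # V) ! Suc (Suc m) = 1"
        using IH[of m] Cons.prems by simp
      then show ?thesis
        unfolding Z m by (simp only: nth_append_length_plus flip: add_Suc_right)
    qed
  qed simp
  let ?Y = "concat Bs"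
  let ?f = "infinite_power ?Y"
  obtain V where V: "?Y = 0 # 1 # V"
    using assms by (cases Bs) auto
  have ext: "?f n = (?Y @ [0, 1]) ! n" if "n < length ?Y + 2" for n
  proof (cases "n < length ?Y")
    case False
    then have "n = length ?Y \<or> n = length ?Y + 1"
      using that by linarith
    moreover have "infinite_power ?Y (length ?Y) = 0" "infinite_power ?Y (length ?Y + 1) = 1"
      using infinite_power_periodic[of ?Y 0] infinite_power_periodic[of ?Y 1] V
      by (simp_all add: infinite_power_def)
    ultimately show ?thesis
      by (auto simp: nth_append)
  qed (simp add: infinite_power_def nth_append)
  show ?thesis
    unfolding zero_iff_between_ones_def
  proof
    fix n
    define m where "m = n mod length ?Y"
    have m: "m < length ?Y"
      using V by (simp add: m_def)
    have "?f (n + k) = ?f (m + k)" for k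
      by (simp add: infinite_power_def m_def mod_add_left_eq)
    from this[of 0] this[of 1] this[of 2]
    show "?f (Suc n) = 0 \<longleftrightarrow> ?f n = 1 \<and> ?f (Suc (Suc n)) = 1"
      using local[OF assms(1) m refl] ext[of m] ext[of "Suc m"] ext[of "Suc (Suc m)"] m
      by simp
  qed
qed

lemma between_ones_iff_rotation_of_blocks:
  assumes "X \<noteq> []" and "set X \<subseteq> {0, 1}"
  shows "zero_iff_between_ones (infinite_power X) \<longleftrightarrow>
    (\<exists>Bs. set Bs \<subseteq> {[0, 1], [0, 1, 1]} \<and> cyclic_rotation X (concat Bs))"
proof
  let ?f = "infinite_power X"
  have bits: "?f n \<in> {0, 1}" for n
    using infinite_power_mem[OF assms(1)] assms(2) by blast
  assume between: "zero_iff_between_ones ?f"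
  \<comment> \<open>One of the first three letters is zero: if the middle one is not, its neighbours
    are not both 1.\<close>
  obtain j where j: "?f j = 0"
    using between[unfolded zero_iff_between_ones_def, rule_format, of 0]
      bits[of 0] bits[of "Suc 0"] bits[of "Suc (Suc 0)"] by auto
  \<comment> \<open>The range starts at 1 so that the rotation back, by \<open>length X - i\<close>,
    is strictly below the length, as \<open>cyclic_rotation\<close> demands.\<close>
  obtain i where i: "?f i = 0" "0 < i" "i \<le> length X"
  proof (cases "j mod length X = 0")
    case True
    then have "?f (length X) = 0"
      using j by (simp add: infinite_power_def)
    then show ?thesis
      using that[of "length X"] assms(1) by simp
  next
    case False
    moreover have "?f (j mod length X) = 0"
      using j by (simp add: infinite_power_def)
    ultimately show ?thesis
      using that[of "j mod length X"] assms(1) by (simp add: less_imp_le)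
  qed
  have "?f (i + length X) = 0"
    using i by (simp only: infinite_power_periodic)
  then obtain Bs where Bs: "set Bs \<subseteq> {[0, 1], [0, 1, 1]}" "rotate i X = concat Bs"
    using between_ones_imp_blocks[OF between bits, of i "i + length X"] i
    by (auto simp: map_infinite_power)
  have "X = rotate (length X - i) (rotate i X)"
    using i by (simp add: rotate_rotate)
  moreover have "length X - i < length (rotate i X)"
    using i by simp
  ultimately have "cyclic_rotation X (concat Bs)"
    unfolding cyclic_rotation_iff_rotate Bs(2) by blast
  with Bs show "\<exists>Bs. set Bs \<subseteq> {[0, 1], [0, 1, 1]} \<and> cyclic_rotation X (concat Bs)"
    by blast
next
  assume "\<exists>Bs. set Bs \<subseteq> {[0, 1], [0, 1, 1]} \<and> cyclic_rotation X (concat Bs)"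
  then obtain Bs t where Bs: "set Bs \<subseteq> {[0, 1], [0, 1, 1]}"
    and X: "X = rotate t (concat Bs)"
    unfolding cyclic_rotation_iff_rotate by blast
  have ne: "concat Bs \<noteq> []"
    using assms(1) X by (metis rotate_is_Nil_conv)
  then have "Bs \<noteq> []"
    by auto
  from blocks_imp_between_ones[OF Bs this]
  show "zero_iff_between_ones (infinite_power X)"
    unfolding zero_iff_between_ones_def X infinite_power_rotate[OF ne] by simp
qed

theorem theorem3p5:
  fixes b :: nat and X :: "nat list"
  assumes "2 \<le> b"
    and "X \<noteq> []"
    and "set X \<subseteq> {0, 1}"
    and "least_period (infinite_power X) = length X"
  shows "infinite_power X \<in> words {1, b} \<longleftrightarrow>
    length X dvd 1 + b \<and>
    (\<exists>Bs. set Bs \<subseteq> {[0, 1], [0, 1, 1]} \<and> cyclic_rotation X (concat Bs))"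
proof -
  let ?f = "infinite_power X"
  let ?rec = "\<forall>n. ?f (n + b) = 1 - min (?f (n + b - 1)) (?f n)"
  have b: "0 < b" and p: "0 < length X"
    using assms by auto
  have bits: "?f n \<in> {0, 1}" for n
    using infinite_power_mem[OF assms(2)] assms(3) by blast
  have rec_dvd: "length X dvd 1 + b" if ?rec
  proof -
    have "?f (n + (b + 1)) = ?f n" for n
      using recurrence_imp_period[where f = ?f, OF b p infinite_power_periodic bits] that
      by blast
    then have "least_period ?f dvd b + 1"
      by (intro least_period_dvd) simp_all
    then show ?thesis
      using assms(4) by simp
  qed
  have rec_iff: "?rec \<longleftrightarrow> zero_iff_between_ones ?f" if "length X dvd 1 + b"
  proof -
    from that obtain k where "1 + b = length X * k"
      by (rule dvdE)
    then have "b + 1 = k * length X"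
      by (simp add: mult.commute)
    then have "?f (n + (b + 1)) = ?f n" for n
      by (simp only: periodic_mult[of ?f, OF infinite_power_periodic])
    then show ?thesis
      by (rule recurrence_iff_between_ones[where f = ?f, OF b _ bits])
  qed
  have "?f \<in> words {1, b} \<longleftrightarrow> ?rec"
    by (rule periodic_in_words_iff[where f = ?f, OF b p infinite_power_periodic bits])
  \<comment> \<open>The recurrence yields divisibility, and under divisibility it is equivalent to
    the local condition.\<close>
  also have "\<dots> \<longleftrightarrow> length X dvd 1 + b \<and> zero_iff_between_ones ?f"
    using rec_dvd rec_iff by argo
  also have "zero_iff_between_ones ?f \<longleftrightarrow>
      (\<exists>Bs. set Bs \<subseteq> {[0, 1], [0, 1, 1]} \<and> cyclic_rotation X (concat Bs))"
    by (rule between_ones_iff_rotation_of_blocks[OF assms(2,3)])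
  finally show ?thesis .
qed

end
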